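(* Let $\Omega\subset\mathbb{R}^2$ be a domain, let $\Gamma\subset\Omega$ be a connected piece of a parabola, and let $\tau$ and $T$ be open curves (nonempty, connected, relatively open pieces of $\Gamma$) with $\tau\subset T\subset\subset\Gamma$. Then there is $\kappa\in(0,1)$, depending on $\tau$ and $T$ (with $\Omega$ fixed), such that for every $M>0$ there is a constant $C=C(M,\tau,T)>0$, independent of $u$, for which the following holds: for every harmonic function $u\in C^2(\Omega)$ with $\|u\|_{C(\Omega)}\le M$, $$\|u\|_{C(T)}\le C\,\|u\|_{C(\tau)}^{\kappa}.$$
   Context: For a set $S$, $\|u\|_{C(S)}=\sup_{\mathbf{x}\in S}|u(\mathbf{x})|$. $T\subset\subset\Gamma$ means that the closure of $T$ is compact and contained in $\Gamma$. $u$ is harmonic in $\Omega$ if $\Delta u=0$ in $\Omega$. *)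

theory Defs
  imports "HOL-Analysis.Analysis"
begin

definition partial_deriv :: "'n::finite \<Rightarrow> (real^'n \<Rightarrow> real) \<Rightarrow> real^'n \<Rightarrow> real" where
  "partial_deriv i u x = frechet_derivative u (at x) (axis i 1)"

text \<open>\<open>C1_on\<close>, \<open>C2_on\<close> and \<open>harmonic_on\<close> are meant for open \<open>S\<close>: derivatives are taken in the full
  neighbourhood filter \<open>at x\<close>, so the values of \<open>u\<close> off \<open>S\<close> are irrelevant there.\<close>

definition C1_on :: "(real^'n::finite) set \<Rightarrow> (real^'n \<Rightarrow> real) \<Rightarrow> bool" where
  "C1_on S u \<longleftrightarrow>
     (\<forall>x\<in>S. u differentiable (at x)) \<and> (\<forall>i. continuous_on S (partial_deriv i u))"

definition C2_on :: "(real^'n::finite) set \<Rightarrow> (real^'n \<Rightarrow> real) \<Rightarrow> bool" where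
  "C2_on S u \<longleftrightarrow> C1_on S u \<and> (\<forall>i. C1_on S (partial_deriv i u))"

definition laplacian :: "(real^'n::finite \<Rightarrow> real) \<Rightarrow> real^'n \<Rightarrow> real" where
  "laplacian u x = (\<Sum>i\<in>UNIV. partial_deriv i (partial_deriv i u) x)"

definition harmonic_on :: "(real^'n::finite) set \<Rightarrow> (real^'n \<Rightarrow> real) \<Rightarrow> bool" where
  "harmonic_on S u \<longleftrightarrow> C2_on S u \<and> (\<forall>x\<in>S. laplacian u x = 0)"

text \<open>A real-valued supremum: it is the norm of \<open>C(S)\<close> only when \<open>S\<close> is nonempty and \<open>u\<close> is
  bounded on \<open>S\<close>, so boundedness has to be assumed alongside any bound on it.\<close>

definition C_norm :: "'a set \<Rightarrow> ('a \<Rightarrow> real) \<Rightarrow> real" where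
  "C_norm S u = (SUP x\<in>S. \<bar>u x\<bar>)"

text \<open>Focus \<open>F\<close> and directrix \<open>L\<close>; the condition \<open>F \<notin> L\<close> excludes degenerate conics.\<close>

definition is_parabola :: "(real^2) set \<Rightarrow> bool" where
  "is_parabola P \<longleftrightarrow>
     (\<exists>F L. affine L \<and> aff_dim L = 1 \<and> F \<notin> L \<and> P = {x. dist x F = infdist x L})"

definition parabola_piece :: "(real^2) set \<Rightarrow> bool" where
  "parabola_piece \<Gamma> \<longleftrightarrow> connected \<Gamma> \<and> (\<exists>P. is_parabola P \<and> \<Gamma> \<subseteq> P)"

definition open_curve_in :: "(real^2) set \<Rightarrow> (real^2) set \<Rightarrow> bool" where
  "open_curve_in \<Gamma> T \<longleftrightarrow> T \<noteq> {} \<and> connected T \<and> openin (top_of_set \<Gamma>) T"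

definition compactly_contained :: "'a::topological_space set \<Rightarrow> 'a set \<Rightarrow> bool" where
  "compactly_contained T \<Gamma> \<longleftrightarrow> compact (closure T) \<and> closure T \<subseteq> \<Gamma>"

end

theory Submission
  imports Defs "HOL-Complex_Analysis.Complex_Analysis"
begin

text \<open>
  Restricted to a parabola, a harmonic function is real analytic, and real analytic functions with a
  uniform complex bound cannot be small on a piece of an arc without being small, in the Hoelder
  sense, on the rest of it.

  The parabola is the image of the real line under a quadratic polynomial \<open>q\<close> with complex
  coefficients (lemma \<open>parabola_entire_parametrization\<close>). On a disc inside \<open>\<Omega>\<close> the harmonic function
  is \<open>u = Re F\<close> with \<open>F\<close> holomorphic, so \<open>u (q t)\<close> is the restriction to real \<open>t\<close> of the holomorphic
  function \<open>(F (q t) + cnj (F (q (cnj t)))) / 2\<close>. If \<open>\<bar>u\<bar> \<le> M\<close>, this extension is bounded by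
  \<open>M + exp (2 * M)\<close> on a complex disc whose radius does not depend on \<open>u\<close> (lemma
  \<open>harmonic_on_curve_extends\<close>). The dependence on \<open>M\<close> is crude, but \<open>M\<close> enters only the constant \<open>C\<close>.

  For a holomorphic \<open>f\<close> with \<open>\<bar>f\<bar> \<le> K\<close> on a disc and \<open>\<bar>f\<bar> \<le> e\<close> on a real segment, compare \<open>f\<close> with the
  polynomial interpolating it at \<open>m + 1\<close> equally spaced points of the segment. The polynomial is at most
  of order \<open>A ^ m * e\<close>, and the error, which has \<open>m + 1\<close> zeros clustered near the centre, is at
  most of order \<open>K / 2 ^ m\<close> there by the maximum principle. A suitable choice of \<open>m\<close> turns the sum
  into \<open>C * e powr \<kappa>\<close> with \<open>\<kappa>\<close> depending on the geometry only (lemma \<open>two_constants_on_segment\<close>).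

  This is a local statement: each point of \<open>\<Gamma>\<close> has a neighbourhood in which smallness spreads from any
  relatively open piece. Such estimates compose, the exponents being multiplied, so the points of \<open>\<Gamma>\<close>
  reached from \<open>\<tau>\<close> form a relatively open and closed set. By connectedness they are all of
  \<open>\<Gamma>\<close>, and finitely many neighbourhoods cover the compact set \<open>closure T\<close> (lemma
  \<open>smallness_propagates_compact\<close>).
\<close>

section \<open>Harmonic functions as real parts\<close>

lemma C1_on_line_derivative:
  assumes "C1_on S u" and "w + s *\<^sub>R axis i 1 \<in> S"
  shows "((\<lambda>s. u (w + s *\<^sub>R axis i 1)) has_real_derivative
          partial_deriv i u (w + s *\<^sub>R axis i 1)) (at s)"
proof -
  let ?l = "\<lambda>s. w + s *\<^sub>R axis i (1::real)"
  let ?D = "frechet_derivative u (at (?l s))"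
  have D: "(u has_derivative ?D) (at (?l s))"
    using assms unfolding C1_on_def by (auto simp flip: frechet_derivative_works)
  have "(?l has_derivative (\<lambda>h. h *\<^sub>R axis i 1)) (at s)"
    by (auto intro!: derivative_eq_intros)
  from diff_chain_at[OF this D]
  have "((\<lambda>s. u (?l s)) has_derivative (\<lambda>h. ?D (h *\<^sub>R axis i 1))) (at s)"
    by (simp add: o_def)
  moreover have "?D (h *\<^sub>R axis i 1) = partial_deriv i u (?l s) * h" for h
    using linear_scale[OF has_derivative_linear[OF D]] by (simp add: partial_deriv_def)
  ultimately show ?thesis by (simp add: has_field_derivative_def)
qed

text \<open>
  Two applications of the mean value theorem, first in direction \<open>i\<close>, then in direction \<open>j\<close>. The left-hand
  side is symmetric in \<open>i\<close> and \<open>j\<close>, which is what makes the mixed derivatives agree.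
\<close>

lemma second_difference_mean_value:
  assumes C: "C2_on S u" and h: "0 < h"
    and box: "\<And>s t. \<lbrakk>0 \<le> s; s \<le> h; 0 \<le> t; t \<le> h\<rbrakk> \<Longrightarrow> x + s *\<^sub>R axis i 1 + t *\<^sub>R axis j 1 \<in> S"
  shows "\<exists>s t. 0 < s \<and> s < h \<and> 0 < t \<and> t < h \<and>
     u (x + h *\<^sub>R axis i 1 + h *\<^sub>R axis j 1) - u (x + h *\<^sub>R axis i 1)
       - u (x + h *\<^sub>R axis j 1) + u x
     = h * (h * partial_deriv j (partial_deriv i u) (x + s *\<^sub>R axis i 1 + t *\<^sub>R axis j 1))"
proof -
  let ?p = "\<lambda>s t. x + s *\<^sub>R axis i (1::real) + t *\<^sub>R axis j (1::real)"
  have C1: "C1_on S u" "C1_on S (partial_deriv i u)" using C by (auto simp: C2_on_def)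
  have di: "((\<lambda>s. u (?p s t)) has_real_derivative partial_deriv i u (?p s t)) (at s)"
    if "0 \<le> s" "s \<le> h" "0 \<le> t" "t \<le> h" for s t
    using C1_on_line_derivative[OF C1(1), of "x + t *\<^sub>R axis j 1" s i] box[OF that]
    by (simp add: algebra_simps)
  have "\<exists>s. 0 < s \<and> s < h \<and> (u (?p h h) - u (?p h 0)) - (u (?p 0 h) - u (?p 0 0))
      = (h - 0) * (partial_deriv i u (?p s h) - partial_deriv i u (?p s 0))"
    by (rule MVT2[OF h]) (intro DERIV_diff di; use h in simp)
  then obtain s where s: "0 < s" "s < h"
    and 1: "(u (?p h h) - u (?p h 0)) - (u (?p 0 h) - u (?p 0 0))
      = h * (partial_deriv i u (?p s h) - partial_deriv i u (?p s 0))" by auto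
  have "\<exists>t. 0 < t \<and> t < h \<and> partial_deriv i u (?p s h) - partial_deriv i u (?p s 0)
      = (h - 0) * partial_deriv j (partial_deriv i u) (?p s t)"
    by (rule MVT2[OF h]) (use C1_on_line_derivative[OF C1(2)] box s in auto)
  then obtain t where "0 < t" "t < h"
    and "partial_deriv i u (?p s h) - partial_deriv i u (?p s 0)
      = h * partial_deriv j (partial_deriv i u) (?p s t)" by auto
  with 1 s show ?thesis
    by (intro exI[of _ s] exI[of _ t]) simp
qed

lemma partial_deriv_commute:
  assumes S: "open S" and x: "x \<in> S" and C: "C2_on S u"
  shows "partial_deriv i (partial_deriv j u) x = partial_deriv j (partial_deriv i u) x"
proof -
  let ?a = "partial_deriv j (partial_deriv i u)" and ?b = "partial_deriv i (partial_deriv j u)"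
  have cont: "continuous_on S ?a" "continuous_on S ?b"
    using C by (auto simp: C2_on_def C1_on_def)
  have "\<bar>?a x - ?b x\<bar> < e" if e: "0 < e" for e
  proof -
    have "isCont ?a x" "isCont ?b x"
      using cont S x by (simp_all add: continuous_on_eq_continuous_at)
    then obtain d1 d2 where d: "0 < d1" "0 < d2"
      and d1: "\<And>y. dist y x < d1 \<Longrightarrow> dist (?a y) (?a x) < e/2"
      and d2: "\<And>y. dist y x < d2 \<Longrightarrow> dist (?b y) (?b x) < e/2"
      unfolding continuous_at_eps_delta using e by (metis half_gt_zero)
    obtain d3 where d3: "0 < d3" "ball x d3 \<subseteq> S" using S x openE by blast
    define h where "h = Min {d1,d2,d3} / 3"
    have h: "0 < h" "3*h \<le> d1" "3*h \<le> d2" "3*h \<le> d3" using d d3 by (auto simp: h_def)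
    have near: "dist (x + s *\<^sub>R axis k 1 + t *\<^sub>R axis l 1) x < 3 * h"
      if "0 \<le> s" "s \<le> h" "0 \<le> t" "t \<le> h" for s t :: real and k l
    proof -
      have "dist (x + s *\<^sub>R axis k 1 + t *\<^sub>R axis l 1) x = norm (s *\<^sub>R axis k (1::real) + t *\<^sub>R axis l (1::real))"
        by (simp add: dist_norm algebra_simps)
      also have "\<dots> \<le> s + t"
        using norm_triangle_ineq[of "s *\<^sub>R axis k (1::real)" "t *\<^sub>R axis l (1::real)"] that
        by (simp add: norm_axis_1)
      finally show ?thesis using that h(1) by simp
    qed
    have box: "x + s *\<^sub>R axis k 1 + t *\<^sub>R axis l 1 \<in> S"
      if "0 \<le> s" "s \<le> h" "0 \<le> t" "t \<le> h" for s t :: real and k l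
      using near[OF that, of k l] h(4) d3(2) by (auto simp: dist_commute subset_iff)
    obtain s t where st: "0 < s" "s < h" "0 < t" "t < h"
      and 1: "u (x + h *\<^sub>R axis i 1 + h *\<^sub>R axis j 1) - u (x + h *\<^sub>R axis i 1)
       - u (x + h *\<^sub>R axis j 1) + u x = h * (h * ?a (x + s *\<^sub>R axis i 1 + t *\<^sub>R axis j 1))"
      using second_difference_mean_value[OF C h(1) box] by blast
    obtain s' t' where st': "0 < s'" "s' < h" "0 < t'" "t' < h"
      and 2: "u (x + h *\<^sub>R axis j 1 + h *\<^sub>R axis i 1) - u (x + h *\<^sub>R axis j 1)
       - u (x + h *\<^sub>R axis i 1) + u x = h * (h * ?b (x + s' *\<^sub>R axis j 1 + t' *\<^sub>R axis i 1))"
      using second_difference_mean_value[OF C h(1) box] by blast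
    have "h * (h * ?a (x + s *\<^sub>R axis i 1 + t *\<^sub>R axis j 1))
        = h * (h * ?b (x + s' *\<^sub>R axis j 1 + t' *\<^sub>R axis i 1))"
      unfolding 1[symmetric] 2[symmetric] by (simp add: algebra_simps)
    then have "?a (x + s *\<^sub>R axis i 1 + t *\<^sub>R axis j 1) = ?b (x + s' *\<^sub>R axis j 1 + t' *\<^sub>R axis i 1)"
      using h(1) by simp
    moreover have "dist (?a (x + s *\<^sub>R axis i 1 + t *\<^sub>R axis j 1)) (?a x) < e/2"
      by (rule d1) (use near[of s t i j] st h in linarith)
    moreover have "dist (?b (x + s' *\<^sub>R axis j 1 + t' *\<^sub>R axis i 1)) (?b x) < e/2"
      by (rule d2) (use near[of s' t' j i] st' h in linarith)
    ultimately show ?thesis unfolding dist_real_def by linarith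
  qed
  then have "\<bar>?a x - ?b x\<bar> \<le> 0" by (meson less_irrefl not_le)
  then show ?thesis by simp
qed

definition complex_of_vec :: "real^2 \<Rightarrow> complex" where
  "complex_of_vec x = Complex (x$1) (x$2)"

definition vec_of_complex :: "complex \<Rightarrow> real^2" where
  "vec_of_complex z = vector [Re z, Im z]"

lemma vec_of_complex_nth [simp]: "vec_of_complex z $ 1 = Re z" "vec_of_complex z $ 2 = Im z"
  by (simp_all add: vec_of_complex_def)

lemma vec_of_complex_of_vec [simp]: "vec_of_complex (complex_of_vec x) = x"
  by (simp add: vec_eq_iff forall_2 complex_of_vec_def)

lemma vec_of_complex_axes: "vec_of_complex z = Re z *\<^sub>R axis 1 1 + Im z *\<^sub>R axis 2 1"
  by (simp add: vec_eq_iff forall_2 axis_def)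

lemma dist_vec_of_complex: "dist (vec_of_complex z) (vec_of_complex w) = dist z w"
  by (simp add: dist_vec_def L2_set_def sum_2 dist_complex_def cmod_def dist_real_def)

lemma vec_of_complex_has_derivative: "(vec_of_complex has_derivative vec_of_complex) (at z)"
proof -
  have "vec_of_complex = (\<lambda>z. Re z *\<^sub>R axis 1 1 + Im z *\<^sub>R axis 2 1)"
    by (rule ext) (rule vec_of_complex_axes)
  moreover have "((\<lambda>z. Re z *\<^sub>R axis 1 (1::real) + Im z *\<^sub>R axis 2 (1::real)::real^2) has_derivative
      (\<lambda>z. Re z *\<^sub>R axis 1 1 + Im z *\<^sub>R axis 2 1)) (at z)"
    by (auto intro!: derivative_eq_intros)
  ultimately show ?thesis by simp
qed

lemma C1_on_has_derivative_complex:
  fixes v :: "real^2 \<Rightarrow> real"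
  assumes "C1_on S v" and "vec_of_complex z \<in> S"
  shows "((\<lambda>z. v (vec_of_complex z)) has_derivative
     (\<lambda>h. Re h * partial_deriv 1 v (vec_of_complex z) + Im h * partial_deriv 2 v (vec_of_complex z))) (at z)"
proof -
  let ?D = "frechet_derivative v (at (vec_of_complex z))"
  have D: "(v has_derivative ?D) (at (vec_of_complex z))"
    using assms unfolding C1_on_def by (auto simp flip: frechet_derivative_works)
  have "?D (vec_of_complex h) = Re h * partial_deriv 1 v (vec_of_complex z) + Im h * partial_deriv 2 v (vec_of_complex z)" for h
    using has_derivative_linear[OF D] 
    by (simp add: vec_of_complex_axes[of h] partial_deriv_def linear_add linear_scale)
  then show ?thesis
    using diff_chain_at[OF vec_of_complex_has_derivative D] by (simp add: o_def)
qed

text \<open>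
  The complex gradient \<open>u_x - \<i> u_y\<close> satisfies the Cauchy-Riemann equations: one of them is Laplace's
  equation, the other the symmetry of the second derivatives. On a disc it has a primitive, and the real
  part of a primitive has the same gradient as \<open>u\<close>.
\<close>

lemma harmonic_is_real_part:
  assumes S: "open S" and u: "harmonic_on S u" and sub: "\<And>z. z \<in> ball c R \<Longrightarrow> vec_of_complex z \<in> S"
  shows "\<exists>F. F holomorphic_on ball c R \<and> (\<forall>z\<in>ball c R. Re (F z) = u (vec_of_complex z))"
proof -
  have C: "C2_on S u" and lap: "\<And>x. x \<in> S \<Longrightarrow> partial_deriv 1 (partial_deriv 1 u) x + partial_deriv 2 (partial_deriv 2 u) x = 0"
    using u by (auto simp: harmonic_on_def laplacian_def sum_2)
  have C1: "C1_on S u" "\<And>i. C1_on S (partial_deriv i u)" using C by (auto simp: C2_on_def)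
  define g where "g z = complex_of_real (partial_deriv 1 u (vec_of_complex z)) - \<i> * complex_of_real (partial_deriv 2 u (vec_of_complex z))" for z
  have "g holomorphic_on ball c R"
  proof -
    have "\<exists>D. (g has_field_derivative D) (at z)" if z: "z \<in> ball c R" for z
    proof -
      let ?x = "vec_of_complex z"
      let ?p = "\<lambda>i j. partial_deriv i (partial_deriv j u) ?x"
      have x: "?x \<in> S" using sub z by blast
      have e: "?p 2 2 = - ?p 1 1" "?p 1 2 = ?p 2 1"
        using lap[OF x] partial_deriv_commute[OF S x C, of 1 2] by auto
      let ?D = "complex_of_real (?p 1 1) - \<i> * complex_of_real (?p 2 1)"
      have "(g has_derivative (\<lambda>h. complex_of_real (Re h * ?p 1 1 + Im h * ?p 2 1) - \<i> * complex_of_real (Re h * ?p 1 2 + Im h * ?p 2 2))) (at z)"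
        unfolding g_def
        by (intro has_derivative_diff has_derivative_mult_right has_derivative_of_real
              C1_on_has_derivative_complex[OF C1(2) x])
      also have "(\<lambda>h. complex_of_real (Re h * ?p 1 1 + Im h * ?p 2 1) - \<i> * complex_of_real (Re h * ?p 1 2 + Im h * ?p 2 2)) = (*) ?D"
        unfolding e by (rule ext) (simp add: complex_eq_iff algebra_simps)
      finally show ?thesis unfolding has_field_derivative_def by blast
    qed
    then show ?thesis
      by (auto simp: holomorphic_on_open)
  qed
  then obtain F0 where F0: "\<And>z. z \<in> ball c R \<Longrightarrow> (F0 has_field_derivative g z) (at z)"
    using holomorphic_convex_primitive'[OF convex_ball open_ball]
    by (metis at_within_open open_ball)
  have "((\<lambda>z. u (vec_of_complex z) - Re (F0 z)) has_derivative (\<lambda>h. 0)) (at z within ball c R)" if z: "z \<in> ball c R" for z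
  proof -
    have "((\<lambda>z. u (vec_of_complex z) - Re (F0 z)) has_derivative 
       (\<lambda>h. (Re h * partial_deriv 1 u (vec_of_complex z) + Im h * partial_deriv 2 u (vec_of_complex z)) - Re (g z * h))) (at z)"
      by (intro has_derivative_diff C1_on_has_derivative_complex[OF C1(1) sub[OF z]]
           has_derivative_Re F0[OF z, unfolded has_field_derivative_def])
    then show ?thesis by (auto simp: g_def mult.commute intro: has_derivative_at_withinI)
  qed
  then obtain k where k: "\<And>z. z \<in> ball c R \<Longrightarrow> u (vec_of_complex z) - Re (F0 z) = k"
    using has_derivative_zero_constant[OF convex_ball[of c R],
        of "\<lambda>z. u (vec_of_complex z) - Re (F0 z)"] by blast
  have "F0 holomorphic_on ball c R"
    unfolding holomorphic_on_open[OF open_ball] using F0 by blast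
  moreover have "Re (F0 z + of_real k) = u (vec_of_complex z)" if "z \<in> ball c R" for z
    using k[OF that] by simp
  ultimately show ?thesis
    by (intro exI[of _ "\<lambda>z. F0 z + of_real k"]) (auto intro!: holomorphic_intros)
qed

text \<open>
  Cauchy's inequality for \<open>exp (F z)\<close>, whose modulus lies between \<open>exp (- M)\<close> and \<open>exp M\<close>, bounds the
  logarithmic derivative of \<open>exp (F z)\<close>, which is \<open>F'\<close>, by \<open>2 * exp (2 * M) / R\<close> on the half disc.
\<close>

lemma holomorphic_bounded_if_real_part_bounded:
  assumes F: "F holomorphic_on ball c R" and R: "0 < R"
    and M: "\<And>z. z \<in> ball c R \<Longrightarrow> \<bar>Re (F z)\<bar> \<le> M" and z: "z \<in> ball c (R/2)"
  shows "cmod (F z - F c) \<le> exp (2 * M)"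
proof -
  have F': "(F has_field_derivative deriv F w) (at w)" if "w \<in> ball c R" for w
    using F that holomorphic_derivI by blast
  have bound: "cmod (deriv F w) \<le> 2 * exp (2 * M) / R" if w: "w \<in> ball c (R/2)" for w
  proof -
    have sub: "cball w (R/2) \<subseteq> ball c R"
    proof
      fix y assume "y \<in> cball w (R/2)"
      then show "y \<in> ball c R"
        using w dist_triangle[of c y w] by (simp only: mem_ball mem_cball)
    qed
    have w': "w \<in> ball c R" using w R by simp
    have hol: "(\<lambda>z. exp (F z)) holomorphic_on ball c R"
      using F by (intro holomorphic_intros)
    have "cmod ((deriv ^^ 1) (\<lambda>z. exp (F z)) w) \<le> fact 1 * exp M / (R/2)^1"
    proof (rule Cauchy_inequality)
      show "(\<lambda>z. exp (F z)) holomorphic_on ball w (R/2)"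
        by (rule holomorphic_on_subset[OF hol]) (use sub in auto)
      show "continuous_on (cball w (R/2)) (\<lambda>z. exp (F z))"
        by (rule holomorphic_on_imp_continuous_on, rule holomorphic_on_subset[OF hol sub])
      show "cmod (exp (F x)) \<le> exp M" if "cmod (w - x) = R/2" for x
        using M[of x] sub that by (force simp: dist_norm subset_iff)
    qed (use R in auto)
    moreover have "deriv (\<lambda>z. exp (F z)) w = exp (F w) * deriv F w"
      by (rule DERIV_imp_deriv) (auto intro!: derivative_eq_intros F' w')
    ultimately have "exp (Re (F w)) * cmod (deriv F w) \<le> 2 * exp M / R"
      by (simp add: norm_mult mult.commute)
    moreover have "exp (-M) * cmod (deriv F w) \<le> exp (Re (F w)) * cmod (deriv F w)"
      using M[OF w'] by (intro mult_right_mono) auto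
    ultimately have "exp M * (exp (-M) * cmod (deriv F w)) \<le> exp M * (2 * exp M / R)"
      by (intro mult_left_mono) auto
    then have "(exp M * exp (- M)) * cmod (deriv F w) \<le> 2 * (exp M * exp M) / R"
      by (simp add: ac_simps)
    then show ?thesis by (simp flip: exp_add)
  qed
  have "cmod (F z - F c) \<le> 2 * exp (2 * M) / R * cmod (z - c)"
    by (rule field_differentiable_bound[OF convex_ball[of c "R/2"], where f' = "deriv F"])
       (use R z in \<open>auto intro: bound has_field_derivative_at_within[OF F']\<close>)
  also have "\<dots> \<le> 2 * exp (2 * M) / R * (R / 2)"
    using z R by (intro mult_left_mono) (auto simp: dist_norm norm_minus_commute)
  finally show ?thesis using R by simp
qed


section \<open>Interpolation on a segment and the two-constants estimate\<close>

lemma holomorphic_factor_zeros: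
  fixes f :: "complex \<Rightarrow> complex"
  assumes "finite Z" "open S" "Z \<subseteq> S" "f holomorphic_on S" "\<And>z. z \<in> Z \<Longrightarrow> f z = 0"
  shows "\<exists>g. g holomorphic_on S \<and> (\<forall>z\<in>S. f z = (\<Prod>a\<in>Z. z - a) * g z)"
  using assms
proof (induction Z arbitrary: f rule: finite_induct)
  case empty
  then show ?case by (intro exI[of _ f]) auto
next
  case (insert a Z)
  define f1 where "f1 z = (if z = a then deriv f a else (f z - f a) / (z - a))" for z
  have f1: "f1 holomorphic_on S"
    unfolding f1_def using pole_lemma_open[OF insert.prems(3,1)] .
  have eq: "f z = (z - a) * f1 z" for z
    using insert.prems(4)[of a] by (auto simp: f1_def)
  have "f1 z = 0" if "z \<in> Z" for z
    using insert.prems(4)[of z] that insert.hyps(2) by (auto simp: eq)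
  then obtain g where "g holomorphic_on S" "\<forall>z\<in>S. f1 z = (\<Prod>a\<in>Z. z - a) * g z"
    using insert.IH[OF insert.prems(1) _ f1] insert.prems(2) by auto
  then show ?case
    using insert.hyps by (intro exI[of _ g]) (auto simp: eq)
qed

text \<open>
  After division by \<open>\<Prod>a\<in>Z. z - a\<close> the maximum principle applies. On the circle each factor has modulus at
  least \<open>2 * d\<close>, at \<open>x\<close> at most \<open>d\<close>, so every zero gains a factor \<open>1/2\<close>.
\<close>

lemma holomorphic_small_if_many_zeros:
  assumes f: "f holomorphic_on ball c R" and r: "0 < r" "r < R"
    and Z: "finite Z" "Z \<subseteq> cball c r" and zero: "\<And>z. z \<in> Z \<Longrightarrow> f z = 0"
    and d: "0 < d" "\<And>z w. z \<in> Z \<Longrightarrow> dist c w = r \<Longrightarrow> 2 * d \<le> dist w z"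
    and K: "\<And>w. dist c w = r \<Longrightarrow> cmod (f w) \<le> K"
    and x: "x \<in> cball c r" "\<And>z. z \<in> Z \<Longrightarrow> dist x z \<le> d"
  shows "cmod (f x) \<le> K / 2 ^ card Z"
proof -
  have sub: "cball c r \<subseteq> ball c R" using r by auto
  obtain g where g: "g holomorphic_on ball c R"
    and fg: "\<And>z. z \<in> ball c R \<Longrightarrow> f z = (\<Prod>a\<in>Z. z - a) * g z"
    using holomorphic_factor_zeros[OF Z(1) open_ball _ f zero] Z(2) sub by fastforce
  have "cmod (g x) \<le> K / (2 * d) ^ card Z"
  proof (rule maximum_modulus_frontier[where S = "cball c r" and f = g and \<xi> = x])
    show "g holomorphic_on interior (cball c r)"
      by (rule holomorphic_on_subset[OF g]) (use r in auto)
    show "continuous_on (closure (cball c r)) g"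
      by (rule holomorphic_on_imp_continuous_on, rule holomorphic_on_subset[OF g]) (use r in auto)
    fix w assume "w \<in> frontier (cball c r)"
    then have w: "dist c w = r" using r by simp
    have "(2 * d) ^ card Z = (\<Prod>a\<in>Z. 2 * d)" by simp
    also have "\<dots> \<le> (\<Prod>a\<in>Z. cmod (w - a))"
      using d w by (intro prod_mono) (auto simp: dist_norm)
    finally have "(2 * d) ^ card Z * cmod (g w) \<le> cmod (f w)"
      using fg[of w] w r by (auto simp: norm_mult prod_norm[symmetric] intro: mult_right_mono)
    with K[OF w] show "cmod (g w) \<le> K / (2 * d) ^ card Z"
      using d by (simp add: field_simps)
  qed (use x in auto)
  moreover have "(\<Prod>a\<in>Z. cmod (x - a)) \<le> d ^ card Z"
    using prod_mono[of Z "\<lambda>a. cmod (x - a)" "\<lambda>a. d"] x(2) by (auto simp: dist_norm)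
  ultimately have "(\<Prod>a\<in>Z. cmod (x - a)) * cmod (g x) \<le> d ^ card Z * (K / (2 * d) ^ card Z)"
    using d by (intro mult_mono) auto
  then show ?thesis
    using fg[of x] x sub d by (auto simp: norm_mult prod_norm[symmetric] power_mult_distrib subset_iff)
qed

lemma prod_dist_nat:
  assumes "j \<le> m"
  shows "(\<Prod>k\<in>{..m}-{j}. \<bar>real j - real k\<bar>) = fact j * fact (m - j)"
  using assms
proof (induction m rule: dec_induct)
  case base
  have "{..j}-{j} = {0..<j}" by auto
  moreover have "(\<Prod>k\<in>{0..<j}. \<bar>real j - real k\<bar>) = (\<Prod>k\<in>{0..<j}. real (j - k))"
    by (intro prod.cong) auto
  ultimately show ?case by (simp add: fact_prod_rev)
next
  case (step m)
  have "{..Suc m}-{j} = insert (Suc m) ({..m}-{j})" using step by auto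
  then show ?case using step by (simp add: Suc_diff_le) 
qed

text \<open>
  A single term of the exponential series, used as a weak form of Stirling's formula.
\<close>

lemma Suc_power_le_exp_fact: "real (Suc m) ^ m \<le> exp (real (Suc m)) * fact m"
proof -
  have "real (Suc m) ^ Suc m / fact (Suc m) \<le> exp (real (Suc m))"
    using sum_le_suminf[of "\<lambda>n. real (Suc m) ^ n /\<^sub>R fact n" "{Suc m}", OF summable_exp_generic]
    by (simp add: exp_def divide_inverse mult.commute del: of_nat_Suc power_Suc)
  then show ?thesis by (simp add: field_simps del: of_nat_Suc)
qed

text \<open>
  The step is \<open>l / (m + 1)\<close>, so that \<open>m = 0\<close> is no exception; the last node stays short of the end
  point \<open>a + l\<close>.
\<close>

definition equispaced_node :: "real \<Rightarrow> real \<Rightarrow> nat \<Rightarrow> nat \<Rightarrow> complex" where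
  "equispaced_node a l m j = of_real (a + real j * (l / real (Suc m)))"

definition lagrange_interpolant :: "(complex \<Rightarrow> complex) \<Rightarrow> real \<Rightarrow> real \<Rightarrow> nat \<Rightarrow> complex \<Rightarrow> complex" where
  "lagrange_interpolant f a l m z = (\<Sum>j\<le>m. f (equispaced_node a l m j) *
     (\<Prod>k\<in>{..m}-{j}. (z - equispaced_node a l m k) / (equispaced_node a l m j - equispaced_node a l m k)))"

lemma equispaced_node_diff:
  "equispaced_node a l m j - equispaced_node a l m k = of_real ((real j - real k) * (l / real (Suc m)))"
proof -
  have "(a + real j * x) - (a + real k * x) = (real j - real k) * x" for x
    by (simp add: algebra_simps)
  then show ?thesis unfolding equispaced_node_def of_real_diff[symmetric] by (simp only: add_diff_cancel_left)
qed

lemma equispaced_node_inj: "l \<noteq> 0 \<Longrightarrow> equispaced_node a l m j = equispaced_node a l m k \<longleftrightarrow> j = k"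
  using equispaced_node_diff[of a l m j k] by (auto simp del: of_nat_Suc)

lemma equispaced_node_in_segment:
  assumes "0 < l" "j \<le> m"
  shows "\<exists>t\<in>{a..a+l}. equispaced_node a l m j = of_real t"
proof -
  have "real j * (l / real (Suc m)) \<le> real (Suc m) * (l / real (Suc m))"
    using assms by (intro mult_right_mono) auto
  then show ?thesis using assms unfolding equispaced_node_def
    by (intro bexI[where x = "a + real j * (l / real (Suc m))"]) (auto simp del: of_nat_Suc)
qed

lemma lagrange_interpolant_holomorphic: "0 < l \<Longrightarrow> lagrange_interpolant f a l m holomorphic_on S"
  unfolding lagrange_interpolant_def
  by (intro holomorphic_intros) (auto simp: equispaced_node_inj)

lemma lagrange_interpolant_at_node:
  assumes "0 < l" "i \<le> m"
  shows "lagrange_interpolant f a l m (equispaced_node a l m i) = f (equispaced_node a l m i)"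
proof -
  let ?x = "equispaced_node a l m"
  have p: "(\<Prod>k\<in>{..m}-{j}. (?x i - ?x k) / (?x j - ?x k)) = (if j = i then 1 else 0)" if "j \<le> m" for j
    using assms that by (auto simp: equispaced_node_inj intro!: prod_zero)
  have "lagrange_interpolant f a l m (?x i) = (\<Sum>j\<le>m. if j = i then f (?x i) else 0)"
    unfolding lagrange_interpolant_def by (intro sum.cong) (auto simp: p)
  then show ?thesis using assms by simp
qed

text \<open>
  For equally spaced nodes the denominators are \<open>j! (m - j)!\<close> times the \<open>m\<close>-th power of the step. Summing
  their reciprocals gives \<open>2 ^ m / m!\<close> by the binomial theorem, and the factorial absorbs the power of
  \<open>m + 1\<close> that comes from the small step: the bound grows only geometrically in \<open>m\<close>.
\<close>

lemma lagrange_interpolant_bound: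
  assumes l: "0 < l" and D: "\<And>t. t \<in> {a..a+l} \<Longrightarrow> dist z (of_real t) \<le> D"
    and e: "\<And>t. t \<in> {a..a+l} \<Longrightarrow> cmod (f (of_real t)) \<le> e"
  shows "cmod (lagrange_interpolant f a l m z) \<le> exp 1 * e * (2 * exp 1 * D / l) ^ m"
proof -
  let ?x = "equispaced_node a l m" and ?h = "l / real (Suc m)"
  have D0: "0 \<le> D" using D[of a] l by (auto intro: order_trans[OF zero_le_dist])
  have e0: "0 \<le> e" using e[of a] l by (auto intro: order_trans[OF norm_ge_zero])
  have h: "0 < ?h" "\<bar>?h\<bar> = ?h" using l by simp_all
  have t: "cmod (f (?x j) * (\<Prod>k\<in>{..m}-{j}. (z - ?x k) / (?x j - ?x k)))
     \<le> e * (D / ?h) ^ m / fact m * real (m choose j)" if j: "j \<le> m" for j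
  proof -
    have card: "card ({..m}-{j}) = m" using j by simp
    have num: "(\<Prod>k\<in>{..m}-{j}. cmod (z - ?x k)) \<le> D ^ m"
    proof -
      have "cmod (z - ?x k) \<le> D" if "k \<le> m" for k
        using equispaced_node_in_segment[OF l that, of a] D by (auto simp: dist_norm)
      then have "(\<Prod>k\<in>{..m}-{j}. cmod (z - ?x k)) \<le> (\<Prod>k\<in>{..m}-{j}. D)"
        by (intro prod_mono) auto
      then show ?thesis using card by simp
    qed
    have den: "(\<Prod>k\<in>{..m}-{j}. cmod (?x j - ?x k)) = fact j * fact (m - j) * ?h ^ m"
    proof -
      have "(\<Prod>k\<in>{..m}-{j}. cmod (?x j - ?x k)) = (\<Prod>k\<in>{..m}-{j}. \<bar>real j - real k\<bar> * ?h)"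
        unfolding equispaced_node_diff norm_of_real abs_mult using h(2) by simp
      also have "\<dots> = (\<Prod>k\<in>{..m}-{j}. \<bar>real j - real k\<bar>) * ?h ^ m"
        by (simp only: prod.distrib prod_constant card)
      finally show ?thesis by (simp only: prod_dist_nat[OF j])
    qed
    have "cmod (f (?x j) * (\<Prod>k\<in>{..m}-{j}. (z - ?x k) / (?x j - ?x k)))
       = cmod (f (?x j)) * ((\<Prod>k\<in>{..m}-{j}. cmod (z - ?x k)) / (\<Prod>k\<in>{..m}-{j}. cmod (?x j - ?x k)))"
      by (simp add: norm_mult norm_divide prod_norm[symmetric] prod_dividef)
    also have "\<dots> \<le> e * (D ^ m / (fact j * fact (m - j) * ?h ^ m))"
      unfolding den using equispaced_node_in_segment[OF l j, of a] e num h e0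
      by (intro mult_mono divide_right_mono) (auto simp: prod_nonneg simp del: of_nat_Suc)
    also have "\<dots> = e * (D / ?h) ^ m / fact m * real (m choose j)"
      by (simp add: binomial_fact[OF j] power_divide power_mult_distrib ac_simps del: of_nat_Suc)
    finally show ?thesis .
  qed
  have "cmod (lagrange_interpolant f a l m z) \<le> (\<Sum>j\<le>m. e * (D / ?h) ^ m / fact m * real (m choose j))"
    unfolding lagrange_interpolant_def by (rule sum_norm_le) (use t in auto)
  also have "\<dots> = e * (D / ?h) ^ m / fact m * 2 ^ m"
    by (simp only: sum_distrib_left[symmetric] choose_row_sum flip: of_nat_sum) simp
  also have "\<dots> = (e * (2 * D / l) ^ m) * (real (Suc m) ^ m / fact m)"
    using l by (simp add: power_divide power_mult_distrib field_simps del: of_nat_Suc)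
  also have "\<dots> \<le> (e * (2 * D / l) ^ m) * exp (real (Suc m))"
    using Suc_power_le_exp_fact[of m] e0 D0 l
    by (intro mult_left_mono) (auto simp: divide_le_eq simp del: of_nat_Suc)
  also have "\<dots> = exp 1 * e * (2 * exp 1 * D / l) ^ m"
    by (simp add: exp_add power_divide power_mult_distrib exp_of_nat_mult[of m 1, simplified])
  finally show ?thesis .
qed

text \<open>
  Choose \<open>m\<close> such that \<open>A ^ m\<close> is about \<open>e powr (- 1/2)\<close>. Then both terms are powers of \<open>e\<close>, with exponents
  that depend on \<open>A\<close> and \<open>q\<close> only. For \<open>e \<ge> 1\<close> the a priori bound \<open>K\<close> suffices, and for \<open>e = 0\<close> letting
  \<open>m\<close> tend to infinity gives \<open>y \<le> 0\<close>.
\<close>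

lemma geometric_tradeoff:
  fixes A q :: real
  assumes A: "1 < A" and q: "0 < q" "q < 1"
  shows "\<exists>\<kappa>. 0 < \<kappa> \<and> \<kappa> < 1 \<and> (\<forall>K\<ge>0. \<forall>B\<ge>0. \<exists>C>0. \<forall>e\<ge>0. \<forall>y. 
     y \<le> K \<and> (\<forall>m::nat. y \<le> B * e * A ^ m + K * q ^ m) \<longrightarrow> y \<le> C * e powr \<kappa>)"
proof -
  define k where "k = ln (1/q) / (2 * ln A)"
  define \<kappa> where "\<kappa> = min (1/2) k"
  have lnA: "0 < ln A" using A by simp
  have k: "0 < k" using q lnA by (simp add: k_def)
  have "\<exists>C>0. \<forall>e\<ge>0. \<forall>y. y \<le> K \<and> (\<forall>m::nat. y \<le> B * e * A ^ m + K * q ^ m) \<longrightarrow> y \<le> C * e powr \<kappa>"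
    if K: "0 \<le> K" and B: "0 \<le> B" for K B :: real
  proof (intro exI conjI allI impI)
    show "0 < B + K / q + 1" using K B q by (simp add: add_nonneg_pos)
    fix e y :: real assume e: "0 \<le> e" and y: "y \<le> K \<and> (\<forall>m::nat. y \<le> B * e * A ^ m + K * q ^ m)"
    have Kq: "K \<le> K / q" using K q by (simp add: field_simps mult_left_le)
    consider "e = 0" | "1 \<le> e" | "0 < e" "e < 1" using e by linarith
    then show "y \<le> (B + K / q + 1) * e powr \<kappa>"
    proof cases
      case 1
      have "(\<lambda>m. K * q ^ m) \<longlonglongrightarrow> K * 0"
        using q by (intro tendsto_intros LIMSEQ_realpow_zero) auto
      then have "y \<le> K * 0" by (rule LIMSEQ_le_const) (use y 1 in auto)
      then show ?thesis using 1 by simp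
    next
      case 2
      have "y \<le> K / q" using y Kq by linarith
      also have "\<dots> \<le> (B + K / q + 1) * 1" using B by simp
      also have "\<dots> \<le> (B + K / q + 1) * e powr \<kappa>"
        using 2 k K B q by (intro mult_left_mono ge_one_powr_ge_zero) (auto simp: \<kappa>_def)
      finally show ?thesis .
    next
      case 3
      \<comment> \<open>\<open>A powr x = e powr (- 1/2)\<close>\<close>
      define x where "x = ln (1/e) / (2 * ln A)"
      define m where "m = nat \<lfloor>x\<rfloor>"
      have x0: "0 \<le> x" using 3 lnA by (simp add: x_def)
      have m: "real m \<le> x" "x \<le> real m + 1" using x0 unfolding m_def by linarith+
      have le: "e powr a \<le> e powr \<kappa>" if "\<kappa> \<le> a" for a
        using 3 that by (simp add: powr_mono')
      have "e * A ^ m = exp (ln e + real m * ln A)"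
        using 3 A by (simp add: exp_add exp_of_nat_mult)
      also have "\<dots> \<le> exp (ln e + x * ln A)" using m lnA by simp
      also have "x * ln A = - ln e / 2" using lnA 3 by (simp add: x_def ln_div)
      also have "exp (ln e + - ln e / 2) = e powr (1/2)" using 3 by (simp add: powr_def)
      also have "\<dots> \<le> e powr \<kappa>" by (rule le) (simp add: \<kappa>_def)
      finally have 1: "e * A ^ m \<le> e powr \<kappa>" .
      have "q ^ m * q = exp ((real m + 1) * ln q)"
        using q by (simp add: distrib_right exp_add exp_of_nat_mult)
      also have "\<dots> \<le> exp (x * ln q)" using m q by simp
      also have "x * ln q = k * ln e" using lnA 3 q by (simp add: x_def k_def ln_div)
      also have "exp (k * ln e) = e powr k" using 3 by (simp add: powr_def)
      also have "\<dots> \<le> e powr \<kappa>" by (rule le) (simp add: \<kappa>_def)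
      finally have 2: "q ^ m \<le> e powr \<kappa> / q" using q by (simp add: field_simps)
      have "y \<le> B * (e * A ^ m) + K * q ^ m" using y by (simp add: mult.assoc)
      also have "\<dots> \<le> B * e powr \<kappa> + K * (e powr \<kappa> / q)"
        using 1 2 B K by (intro add_mono mult_left_mono) auto
      also have "\<dots> \<le> (B + K / q + 1) * e powr \<kappa>" by (simp add: algebra_simps)
      finally show ?thesis .
    qed
  qed
  moreover have "0 < \<kappa>" "\<kappa> < 1" using k by (auto simp: \<kappa>_def)
  ultimately show ?thesis by blast
qed

text \<open>
  The interpolation error is bounded on the circle of radius \<open>5 * d\<close>: its points are at distance at least
  \<open>4 * d\<close> from the nodes, which all lie within \<open>d\<close> of \<open>t0\<close>, while points of the target segment are at
  distance at most \<open>2 * d\<close> from them. The quotient of the two distances is the factor \<open>1/2\<close> gained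
  per node.
\<close>

lemma two_constants_on_segment:
  fixes t0 d a b :: real
  assumes d: "0 < d" and ab: "a < b" "t0 - d \<le> a" "b \<le> t0 + d"
  shows "\<exists>\<kappa>. 0 < \<kappa> \<and> \<kappa> < 1 \<and> (\<forall>K\<ge>0. \<exists>C>0. \<forall>f e. 
      f holomorphic_on ball (of_real t0) (6*d) \<and> (\<forall>z\<in>ball (of_real t0) (6*d). cmod (f z) \<le> K)
      \<and> 0 \<le> e \<and> (\<forall>t\<in>{a..b}. cmod (f (of_real t)) \<le> e)
      \<longrightarrow> (\<forall>t\<in>{t0-d..t0+d}. cmod (f (of_real t)) \<le> C * e powr \<kappa>))"
proof -
  define l where "l = b - a"
  define A where "A = 2 * exp 1 * (6*d) / l"
  have l: "0 < l" "l \<le> 2*d" using ab by (auto simp: l_def)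
  have "l < 2 * 1 * (6*d)" using l d by linarith
  also have "\<dots> \<le> 2 * exp 1 * (6*d)" using d by (intro mult_right_mono) auto
  finally have A: "1 < A" unfolding A_def using l(1) by (subst less_divide_eq_1_pos) auto
  have real_dist: "dist (complex_of_real s) (of_real t) = \<bar>s - t\<bar>" for s t
    by (simp add: dist_norm flip: of_real_diff)
  have far: "dist (complex_of_real t0) (of_real t) \<le> d" if "t \<in> {t0-d..t0+d}" for t
    using that unfolding real_dist by auto
  have main: "cmod (f (of_real t)) \<le> (2 * exp 1) * e * A ^ m + K * (1/2) ^ m"
    if f: "f holomorphic_on ball (of_real t0) (6*d)" and K: "\<forall>z\<in>ball (of_real t0) (6*d). cmod (f z) \<le> K"
      and e: "0 \<le> e" "\<forall>t\<in>{a..b}. cmod (f (of_real t)) \<le> e" and t: "t \<in> {t0-d..t0+d}" 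
    for f e K t m
  proof -
    let ?L = "lagrange_interpolant f a l m"
    define Z where "Z = equispaced_node a l m ` {..m}"
    have seg: "{a..a+l} = {a..b}" by (simp add: l_def)
    have Z: "\<exists>s\<in>{a..b}. z = of_real s" if "z \<in> Z" for z
      using that equispaced_node_in_segment[OF l(1), of _ m a] unfolding seg Z_def by auto
    have cardZ: "card Z = Suc m"
      unfolding Z_def by (subst card_image) (use l in \<open>auto simp: inj_on_def equispaced_node_inj\<close>)
    have L: "cmod (?L z) \<le> exp 1 * e * A ^ m" if z: "dist (of_real t0) z \<le> 5*d" for z
      unfolding A_def
    proof (rule lagrange_interpolant_bound[OF l(1)], unfold seg)
      fix s assume "s \<in> {a..b}"
      then have "dist (complex_of_real t0) (of_real s) \<le> d" using ab by (intro far) auto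
      then show "dist z (of_real s) \<le> 6*d" using z dist_triangle3[of z "of_real s" "of_real t0"] by linarith
    qed (use e in auto)
    have "cmod (f (of_real t) - ?L (of_real t)) \<le> (K + exp 1 * e * A ^ m) / 2 ^ card Z"
    proof (rule holomorphic_small_if_many_zeros[where c = "of_real t0" and R = "6*d" and r = "5*d" and d = "2*d" and Z = Z
        and f = "\<lambda>z. f z - ?L z"])
      show "(\<lambda>z. f z - ?L z) holomorphic_on ball (of_real t0) (6*d)"
        by (intro holomorphic_on_diff f lagrange_interpolant_holomorphic l)
      show "Z \<subseteq> cball (of_real t0) (5*d)"
      proof
        fix z assume "z \<in> Z"
        then obtain s where "s \<in> {a..b}" "z = of_real s" using Z by blast
        then show "z \<in> cball (of_real t0) (5*d)" using far[of s] ab d by simp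
      qed
      show "f z - ?L z = 0" if "z \<in> Z" for z
        using that lagrange_interpolant_at_node[OF l(1)] by (auto simp: Z_def)
      show "2 * (2*d) \<le> dist w z" if z: "z \<in> Z" and w: "dist (of_real t0) w = 5*d" for z w
      proof -
        have "dist (complex_of_real t0) z \<le> d" using Z[OF z] far ab by auto
        then show ?thesis using w dist_triangle[of "of_real t0" w z] by (simp add: dist_commute)
      qed
      show "cmod (f w - ?L w) \<le> K + exp 1 * e * A ^ m" if w: "dist (of_real t0) w = 5*d" for w
        using norm_triangle_ineq4[of "f w" "?L w"] K[rule_format, of w] L[of w] w d by auto
      show "dist (of_real t) z \<le> 2*d" if z: "z \<in> Z" for z
        using Z[OF z] t ab unfolding real_dist[symmetric] by (auto simp only: real_dist atLeastAtMost_iff)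
      show "of_real t \<in> cball (complex_of_real t0) (5*d)"
        using far[OF t] d by simp
    qed (use d in \<open>auto simp: Z_def\<close>)
    also have "\<dots> \<le> K * (1/2) ^ m + exp 1 * e * A ^ m"
    proof -
      have "0 \<le> K" using K[rule_format, of "of_real t0"] d by (auto intro: order_trans[OF norm_ge_zero])
      moreover have "0 \<le> exp 1 * e * A ^ m" using e A by simp
      ultimately have "(K + exp 1 * e * A ^ m) / 2 ^ Suc m \<le> K / 2 ^ m + (exp 1 * e * A ^ m) / 1"
        unfolding add_divide_distrib using one_le_power[of "2::real" "Suc m"]
        by (intro add_mono divide_left_mono) auto
      then show ?thesis by (simp only: cardZ) (simp add: power_one_over field_simps)
    qed
    finally have "cmod (f (of_real t) - ?L (of_real t)) \<le> K * (1/2) ^ m + exp 1 * e * A ^ m" .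
    moreover have "cmod (?L (of_real t)) \<le> exp 1 * e * A ^ m" using far[OF t] d by (intro L) auto
    ultimately show ?thesis
      using norm_triangle_ineq[of "f (of_real t) - ?L (of_real t)" "?L (of_real t)"] by simp
  qed
  obtain \<kappa> where \<kappa>: "0 < \<kappa>" "\<kappa> < 1" and *: "\<And>K B. \<lbrakk>0 \<le> K; 0 \<le> B\<rbrakk> \<Longrightarrow> \<exists>C>0. \<forall>e\<ge>0. \<forall>y. 
     y \<le> K \<and> (\<forall>m::nat. y \<le> B * e * A ^ m + K * (1/2) ^ m) \<longrightarrow> y \<le> C * e powr \<kappa>"
    using geometric_tradeoff[OF A, of "1/2"] by auto
  have ball: "complex_of_real t \<in> ball (of_real t0) (6*d)" if "t \<in> {t0-d..t0+d}" for t
    using far[OF that] d by simp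
  show ?thesis
  proof (rule exI[of _ \<kappa>], intro conjI \<kappa> allI impI)
    fix K :: real assume "0 \<le> K"
    then obtain C where C: "0 < C" and **: "\<And>e y. \<lbrakk>0 \<le> e; y \<le> K; \<And>m::nat. y \<le> (2 * exp 1) * e * A ^ m + K * (1/2) ^ m\<rbrakk> \<Longrightarrow> y \<le> C * e powr \<kappa>"
      using *[of K "2 * exp 1"] by auto
    show "\<exists>C>0. \<forall>f e. 
      f holomorphic_on ball (of_real t0) (6*d) \<and> (\<forall>z\<in>ball (of_real t0) (6*d). cmod (f z) \<le> K)
      \<and> 0 \<le> e \<and> (\<forall>t\<in>{a..b}. cmod (f (of_real t)) \<le> e)
      \<longrightarrow> (\<forall>t\<in>{t0-d..t0+d}. cmod (f (of_real t)) \<le> C * e powr \<kappa>)"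
      by (rule exI[of _ C]) (use C ball in \<open>auto intro!: ** main\<close>)
  qed
qed


section \<open>Parabolas as entire curves\<close>

text \<open>
  Let \<open>w\<close> be the complex coordinate in which the directrix is the real axis. The focus has coordinate
  \<open>f1 + \<i> f2\<close> with \<open>f2 \<noteq> 0\<close>, and equality of distances reads
  \<open>(Re w - f1)^2 + (Im w - f2)^2 = (Im w)^2\<close>, which can be solved for \<open>Im w\<close>. Hence \<open>\<phi> = Re w\<close> is a
  global parameter, in which the parabola is a quadratic polynomial.
\<close>

lemma parabola_entire_parametrization:
  assumes "is_parabola P"
  shows "\<exists>q \<phi>. q holomorphic_on UNIV \<and> continuous_on UNIV \<phi> \<and>
     (\<forall>t. \<phi> (vec_of_complex (q (complex_of_real t))) = t) \<and>
     (\<forall>x\<in>P. vec_of_complex (q (complex_of_real (\<phi> x))) = x)"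
proof -
  obtain F L where L: "affine L" "aff_dim L = 1" and FL: "F \<notin> L" and P: "P = {x. dist x F = infdist x L}"
    using assms unfolding is_parabola_def by blast
  obtain a where a: "a \<in> L" using L(2) by fastforce
  have "L \<noteq> {a}" using L(2) by auto
  then obtain b where b: "b \<in> L" "b \<noteq> a" using a by blast
  have "affine hull {a,b} = affine hull L"
    using aff_dim_eq_full_gen[of "{a,b}" L] a b L(2) by (simp add: aff_dim_2)
  then have Lr: "L = range (\<lambda>t. a + t *\<^sub>R (b - a))"
    using L(1) by (simp add: affine_hull_2_alt hull_same)
  define c where "c = complex_of_vec a"
  define B where "B = complex_of_vec b - c"
  define V where "V = B / of_real (cmod B)"
  have inj: "complex_of_vec x = complex_of_vec y \<longleftrightarrow> x = y" for x y
    by (metis vec_of_complex_of_vec)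
  have B: "B \<noteq> 0" using b(2) by (simp add: B_def c_def inj)
  then have V: "V * cnj V = 1" 
    by (simp add: V_def complex_norm_square[symmetric] power2_eq_square)
  have normV: "cmod V = 1" using B by (simp add: V_def norm_divide)
  have dist: "dist x y = cmod (complex_of_vec x - complex_of_vec y)" for x y
    by (metis dist_vec_of_complex vec_of_complex_of_vec dist_norm)
  \<comment> \<open>The rigid motion that takes the directrix to the real axis.\<close>
  define w where "w x = (complex_of_vec x - c) * cnj V" for x
  have w_vec: "w (vec_of_complex z) = (z - c) * cnj V" for z
    by (simp add: w_def complex_of_vec_def)
  have dist_w: "dist x y = cmod (w x - w y)" for x y
    using normV by (simp add: dist w_def norm_mult flip: left_diff_distrib)
  have wL: "w ` L = \<real>"
  proof -
    have "w (a + t *\<^sub>R (b - a)) = of_real (t * cmod B)" for t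
    proof -
      have "complex_of_vec (a + t *\<^sub>R (b - a)) - c = of_real t * B"
        by (simp add: complex_of_vec_def c_def B_def complex_eq_iff)
      also have "\<dots> = of_real (t * cmod B) * V" using B by (simp add: V_def)
      finally show ?thesis by (simp only: w_def mult.assoc V mult_1_right)
    qed
    then have "w ` L = range (\<lambda>t. of_real (t * cmod B))" by (auto simp: Lr image_image)
    also have "\<dots> = \<real>"
    proof (intro equalityI subsetI)
      fix z :: complex assume "z \<in> \<real>"
      then obtain r where "z = of_real ((r / cmod B) * cmod B)" using B by (auto elim: Reals_cases)
      then show "z \<in> range (\<lambda>t. of_real (t * cmod B))" by blast
    qed auto
    finally show ?thesis .
  qed
  have infdist: "infdist x L = \<bar>Im (w x)\<bar>" for x
  proof (rule antisym)
    obtain y where y: "y \<in> L" "w y = of_real (Re (w x))" using wL by (metis Reals_of_real imageE)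
    have "infdist x L \<le> dist x y" using y by (intro infdist_le)
    also have "w x - w y = \<i> * of_real (Im (w x))" using y by (simp add: complex_eq_iff)
    then have "dist x y = \<bar>Im (w x)\<bar>" by (simp add: dist_w norm_mult)
    finally show "infdist x L \<le> \<bar>Im (w x)\<bar>" .
    show "\<bar>Im (w x)\<bar> \<le> infdist x L"
      unfolding infdist_notempty[OF ex_in_conv[THEN iffD1, OF exI, OF a]]
    proof (rule cINF_greatest)
      fix y assume "y \<in> L"
      then have "Im (w y) = 0" using wL by (metis Reals_cases Im_complex_of_real imageI)
      then show "\<bar>Im (w x)\<bar> \<le> dist x y" using abs_Im_le_cmod[of "w x - w y"] by (simp add: dist_w)
    qed (use a in auto)
  qed
  define f1 f2 where "f1 = Re (w F)" and "f2 = Im (w F)"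
  have f2: "f2 \<noteq> 0"
  proof
    assume "f2 = 0"
    then have "w F \<in> \<real>" by (simp add: complex_is_Real_iff f2_def)
    then obtain y where "y \<in> L" "w y = w F" using wL by (metis imageE)
    then have "dist y F = 0" by (simp add: dist_w)
    then show False using FL \<open>y \<in> L\<close> by simp
  qed
  define q where "q t = c + V * (t + \<i> * ((t - of_real f1)^2 + of_real f2^2) / (2 * of_real f2))" for t
  define \<phi> where "\<phi> x = Re (w x)" for x
  have wq: "w (vec_of_complex (q (of_real t))) = Complex t (((t - f1)^2 + f2^2) / (2*f2))" for t
  proof -
    have "w (vec_of_complex (q (of_real t))) = (V * cnj V) * (of_real t + \<i> * ((of_real t - of_real f1)^2 + of_real f2^2) / (2 * of_real f2))"
      by (simp add: w_vec q_def)
    also have "\<dots> = of_real t + \<i> * of_real (((t - f1)^2 + f2^2) / (2*f2))"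
      unfolding V by simp
    also have "\<dots> = Complex t (((t - f1)^2 + f2^2) / (2*f2))" by (simp add: complex_eq_iff)
    finally show ?thesis .
  qed
  show ?thesis
  proof (intro exI conjI allI ballI)
    show "q holomorphic_on UNIV"
      unfolding q_def using f2 by (intro holomorphic_intros) auto
    have "\<phi> = (\<lambda>x. (x$1 - Re c) * Re V + (x$2 - Im c) * Im V)"
      by (rule ext) (simp add: \<phi>_def w_def complex_of_vec_def)
    moreover have "continuous_on UNIV (\<lambda>x::real^2. (x$1 - Re c) * Re V + (x$2 - Im c) * Im V)"
      by (intro continuous_intros)
    ultimately show "continuous_on UNIV \<phi>" by simp
    show "\<phi> (vec_of_complex (q (of_real t))) = t" for t
      unfolding \<phi>_def wq by simp
    fix x assume "x \<in> P"
    then have "(cmod (w x - w F))^2 = \<bar>Im (w x)\<bar>^2"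
      unfolding P using dist_w infdist by simp
    then have "(Re (w x) - f1)^2 + (Im (w x) - f2)^2 = (Im (w x))^2"
      by (simp add: cmod_power2 f1_def f2_def)
    then have "Im (w x) = ((Re (w x) - f1)^2 + f2^2) / (2*f2)"
      using f2 by (simp add: field_simps power2_eq_square)
    then have "w (vec_of_complex (q (of_real (\<phi> x)))) = w x"
      unfolding wq by (simp add: \<phi>_def complex_eq_iff)
    then have "dist (vec_of_complex (q (of_real (\<phi> x)))) x = 0" unfolding dist_w by simp
    then show "vec_of_complex (q (of_real (\<phi> x))) = x" by simp
  qed
qed

section \<open>Propagation of smallness\<close>

text \<open>
  An arbitrary bound \<open>e\<close> takes the place of the supremum over \<open>B\<close>. This avoids suprema over sets that may
  be empty and makes the estimates composable.
\<close>

definition hoelder_estimate :: "(real^2) set \<Rightarrow> (real^2) set \<Rightarrow> (real^2) set \<Rightarrow> real \<Rightarrow> real \<Rightarrow> real \<Rightarrow> bool" where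
  "hoelder_estimate \<Omega> B A \<kappa> M C \<longleftrightarrow> (\<forall>u e.
     harmonic_on \<Omega> u \<and> (\<forall>x\<in>\<Omega>. \<bar>u x\<bar> \<le> M) \<and> 0 \<le> e \<and> (\<forall>x\<in>B. \<bar>u x\<bar> \<le> e)
     \<longrightarrow> (\<forall>x\<in>A. \<bar>u x\<bar> \<le> C * e powr \<kappa>))"

text \<open>
  The order of the quantifiers matters: the exponent is chosen before the a priori bound \<open>M\<close>.
\<close>

definition smallness_propagates :: "(real^2) set \<Rightarrow> (real^2) set \<Rightarrow> (real^2) set \<Rightarrow> bool" where
  "smallness_propagates \<Omega> B A \<longleftrightarrow>
     (\<exists>\<kappa>. 0 < \<kappa> \<and> \<kappa> < 1 \<and> (\<forall>M>0. \<exists>C>0. hoelder_estimate \<Omega> B A \<kappa> M C))"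

lemma hoelder_estimateI:
  assumes "\<And>u e x. \<lbrakk>harmonic_on \<Omega> u; \<forall>x\<in>\<Omega>. \<bar>u x\<bar> \<le> M; 0 \<le> e; \<forall>x\<in>B. \<bar>u x\<bar> \<le> e; x \<in> A\<rbrakk>
    \<Longrightarrow> \<bar>u x\<bar> \<le> C * e powr \<kappa>"
  shows "hoelder_estimate \<Omega> B A \<kappa> M C"
  using assms unfolding hoelder_estimate_def by simp

lemma hoelder_estimateD:
  assumes "hoelder_estimate \<Omega> B A \<kappa> M C"
    and "harmonic_on \<Omega> u" "\<forall>x\<in>\<Omega>. \<bar>u x\<bar> \<le> M" "0 \<le> e" "\<forall>x\<in>B. \<bar>u x\<bar> \<le> e" "x \<in> A"
  shows "\<bar>u x\<bar> \<le> C * e powr \<kappa>"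
  using assms unfolding hoelder_estimate_def by simp

lemma smallness_propagates_mono:
  assumes "smallness_propagates \<Omega> B A" "B \<subseteq> B'" "A' \<subseteq> A"
  shows "smallness_propagates \<Omega> B' A'"
proof -
  have "hoelder_estimate \<Omega> B' A' \<kappa> M C" if "hoelder_estimate \<Omega> B A \<kappa> M C" for \<kappa> M C
    by (rule hoelder_estimateI, rule hoelder_estimateD[OF that]) (use assms(2,3) in auto)
  then show ?thesis using assms(1) unfolding smallness_propagates_def by meson
qed

lemma smallness_propagates_trans:
  assumes "smallness_propagates \<Omega> D B" "smallness_propagates \<Omega> B A"
  shows "smallness_propagates \<Omega> D A"
proof -
  obtain k1 where k1: "0 < k1" "k1 < 1" and 1: "\<forall>M>0. \<exists>C>0. hoelder_estimate \<Omega> D B k1 M C"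
    using assms(1) unfolding smallness_propagates_def by blast
  obtain k2 where k2: "0 < k2" "k2 < 1" and 2: "\<forall>M>0. \<exists>C>0. hoelder_estimate \<Omega> B A k2 M C"
    using assms(2) unfolding smallness_propagates_def by blast
  have "\<exists>C>0. hoelder_estimate \<Omega> D A (k1 * k2) M C" if M: "0 < M" for M
  proof -
    obtain C1 where C1: "0 < C1" "hoelder_estimate \<Omega> D B k1 M C1" using 1 M by blast
    obtain C2 where C2: "0 < C2" "hoelder_estimate \<Omega> B A k2 M C2" using 2 M by blast
    have "hoelder_estimate \<Omega> D A (k1 * k2) M (C2 * C1 powr k2)"
    proof (rule hoelder_estimateI)
      fix u e x
      assume u: "harmonic_on \<Omega> u" "\<forall>x\<in>\<Omega>. \<bar>u x\<bar> \<le> M" and e: "0 \<le> e" "\<forall>x\<in>D. \<bar>u x\<bar> \<le> e" and x: "x \<in> A"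
      have "\<forall>y\<in>B. \<bar>u y\<bar> \<le> C1 * e powr k1"
        using hoelder_estimateD[OF C1(2) u e] by blast
      then have "\<bar>u x\<bar> \<le> C2 * (C1 * e powr k1) powr k2"
        using C1(1) x by (intro hoelder_estimateD[OF C2(2) u]) auto
      then show "\<bar>u x\<bar> \<le> C2 * C1 powr k2 * e powr (k1 * k2)"
        using C1(1) by (simp add: powr_mult powr_powr mult.assoc)
    qed
    then show ?thesis using C1(1) C2(1) by (intro exI[of _ "C2 * C1 powr k2"]) auto
  qed
  moreover have "0 < k1 * k2" "k1 * k2 < 1"
    using k1 k2 mult_strict_mono[of k1 1 k2 1] by auto
  ultimately show ?thesis unfolding smallness_propagates_def by blast
qed

text \<open>
  For small \<open>e\<close> a smaller exponent is a weaker claim; for \<open>e > 1\<close> the a priori bound takes over.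
\<close>

lemma powr_exponent_weaken:
  assumes "y \<le> M" "y \<le> C * e powr k" "0 \<le> e" "\<kappa> \<le> k" "0 \<le> \<kappa>" "0 \<le> M" "0 \<le> C"
  shows "y \<le> (C + M) * e powr (\<kappa>::real)"
proof (cases "e \<le> 1")
  case True
  have "y \<le> C * e powr \<kappa>" 
    using assms True by (intro order_trans[OF assms(2)] mult_left_mono powr_mono') auto
  also have "\<dots> \<le> (C + M) * e powr \<kappa>" using assms by (intro mult_right_mono) auto
  finally show ?thesis .
next
  case False
  have "y \<le> (C + M) * 1" using assms by simp
  also have "\<dots> \<le> (C + M) * e powr \<kappa>"
    using assms False by (intro mult_left_mono ge_one_powr_ge_zero) auto
  finally show ?thesis .
qed

lemma smallness_propagates_Un:
  assumes "smallness_propagates \<Omega> D A" "smallness_propagates \<Omega> D B" "A \<subseteq> \<Omega>" "B \<subseteq> \<Omega>"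
  shows "smallness_propagates \<Omega> D (A \<union> B)"
proof -
  obtain k1 where k1: "0 < k1" "k1 < 1" and 1: "\<forall>M>0. \<exists>C>0. hoelder_estimate \<Omega> D A k1 M C"
    using assms(1) unfolding smallness_propagates_def by blast
  obtain k2 where k2: "0 < k2" "k2 < 1" and 2: "\<forall>M>0. \<exists>C>0. hoelder_estimate \<Omega> D B k2 M C"
    using assms(2) unfolding smallness_propagates_def by blast
  have "\<exists>C>0. hoelder_estimate \<Omega> D (A \<union> B) (min k1 k2) M C" if M: "0 < M" for M
  proof -
    obtain C1 where C1: "0 < C1" "hoelder_estimate \<Omega> D A k1 M C1" using 1 M by blast
    obtain C2 where C2: "0 < C2" "hoelder_estimate \<Omega> D B k2 M C2" using 2 M by blast
    have "hoelder_estimate \<Omega> D (A \<union> B) (min k1 k2) M (max C1 C2 + M)"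
    proof (rule hoelder_estimateI)
      fix u e x
      assume u: "harmonic_on \<Omega> u" "\<forall>x\<in>\<Omega>. \<bar>u x\<bar> \<le> M" and e: "0 \<le> e" "\<forall>x\<in>D. \<bar>u x\<bar> \<le> e"
        and x: "x \<in> A \<union> B"
      have uM: "\<bar>u x\<bar> \<le> M" using u(2) x assms(3,4) by blast
      from x show "\<bar>u x\<bar> \<le> (max C1 C2 + M) * e powr min k1 k2"
      proof
        assume "x \<in> A"
        then have "\<bar>u x\<bar> \<le> C1 * e powr k1" using hoelder_estimateD[OF C1(2) u e] by blast
        also have "\<dots> \<le> max C1 C2 * e powr k1" by (intro mult_right_mono) auto
        finally show ?thesis
          by (rule powr_exponent_weaken[OF uM]) (use e k1 k2 C1(1) M in auto)
      next
        assume "x \<in> B"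
        then have "\<bar>u x\<bar> \<le> C2 * e powr k2" using hoelder_estimateD[OF C2(2) u e] by blast
        also have "\<dots> \<le> max C1 C2 * e powr k2" by (intro mult_right_mono) auto
        finally show ?thesis
          by (rule powr_exponent_weaken[OF uM]) (use e k1 k2 C1(1) M in auto)
      qed
    qed
    then show ?thesis using C1(1) M by (intro exI[of _ "max C1 C2 + M"]) auto
  qed
  then show ?thesis
    unfolding smallness_propagates_def using k1 k2 by (intro exI[of _ "min k1 k2"]) auto
qed

lemma smallness_propagates_refl:
  assumes "A \<subseteq> \<Omega>"
  shows "smallness_propagates \<Omega> A A"
proof -
  have "hoelder_estimate \<Omega> A A (1/2) M (1 + M)" if "0 < M" for M
  proof (rule hoelder_estimateI)
    fix u :: "real^2 \<Rightarrow> real" and e x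
    assume "\<forall>x\<in>\<Omega>. \<bar>u x\<bar> \<le> M" "0 \<le> e" "\<forall>x\<in>A. \<bar>u x\<bar> \<le> e" "x \<in> A"
    then show "\<bar>u x\<bar> \<le> (1 + M) * e powr (1/2)"
      using assms that by (intro powr_exponent_weaken[where k = 1]) auto
  qed
  then show ?thesis
    unfolding smallness_propagates_def by (intro exI[of _ "1/2"]) (auto intro!: exI[of _ "1 + _"])
qed

lemma smallness_propagates_empty: "smallness_propagates \<Omega> B {}"
  using smallness_propagates_mono[OF smallness_propagates_refl[of "{}"]] by blast

text \<open>
  The points of \<open>\<Gamma>\<close> that have a neighbourhood reached from \<open>\<tau>\<close> form a relatively open set. A point \<open>x\<close>
  whose neighbourhood \<open>V\<close> meets this set belongs to it: smallness passes from \<open>\<tau>\<close> to a relatively open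
  piece of \<open>V\<close>, and from there to \<open>\<Gamma> \<inter> V\<close>. So the set is also closed.
\<close>

lemma smallness_propagates_compact:
  assumes \<Gamma>: "connected \<Gamma>" "\<Gamma> \<subseteq> \<Omega>"
    and local_propagation: "\<And>x. x \<in> \<Gamma> \<Longrightarrow> \<exists>V. open V \<and> x \<in> V \<and>
      (\<forall>W. openin (top_of_set \<Gamma>) W \<and> W \<noteq> {} \<and> W \<subseteq> V \<longrightarrow> smallness_propagates \<Omega> W (\<Gamma> \<inter> V))"
    and \<tau>: "openin (top_of_set \<Gamma>) \<tau>" "\<tau> \<noteq> {}" and K: "compact K" "K \<subseteq> \<Gamma>"
  shows "smallness_propagates \<Omega> \<tau> K"
proof -
  define G where "G = {x\<in>\<Gamma>. \<exists>N. open N \<and> x \<in> N \<and> smallness_propagates \<Omega> \<tau> (\<Gamma> \<inter> N)}"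
  have "openin (top_of_set \<Gamma>) G"
    by (subst openin_subopen) (auto simp: G_def openin_open)
  moreover have "openin (top_of_set \<Gamma>) (\<Gamma> - G)"
  proof (subst openin_subopen, intro ballI)
    fix x assume x: "x \<in> \<Gamma> - G"
    then obtain V where V: "open V" "x \<in> V" and spread: "\<And>W. \<lbrakk>openin (top_of_set \<Gamma>) W; W \<noteq> {}; W \<subseteq> V\<rbrakk>
      \<Longrightarrow> smallness_propagates \<Omega> W (\<Gamma> \<inter> V)" using local_propagation[of x] by blast
    have "\<Gamma> \<inter> V \<inter> G = {}"
    proof (rule ccontr)
      assume "\<Gamma> \<inter> V \<inter> G \<noteq> {}"
      then obtain y N where y: "y \<in> \<Gamma>" "y \<in> V" and N: "open N" "y \<in> N"
        and sN: "smallness_propagates \<Omega> \<tau> (\<Gamma> \<inter> N)" by (auto simp: G_def)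
      have "smallness_propagates \<Omega> (\<Gamma> \<inter> (V \<inter> N)) (\<Gamma> \<inter> V)"
        using y V N by (intro spread openin_open_Int) auto
      moreover have "smallness_propagates \<Omega> \<tau> (\<Gamma> \<inter> (V \<inter> N))"
        by (rule smallness_propagates_mono[OF sN]) auto
      ultimately have "smallness_propagates \<Omega> \<tau> (\<Gamma> \<inter> V)"
        by (rule smallness_propagates_trans[rotated])
      then have "x \<in> G" using V x by (auto simp: G_def)
      then show False using x by blast
    qed
    then show "\<exists>T. openin (top_of_set \<Gamma>) T \<and> x \<in> T \<and> T \<subseteq> \<Gamma> - G"
      using x V by (intro exI[of _ "\<Gamma> \<inter> V"]) auto
  qed
  then have "closedin (top_of_set \<Gamma>) G"
    by (simp add: closedin_def G_def)
  moreover have "G \<noteq> {}"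
  proof -
    obtain z where z: "z \<in> \<tau>" "z \<in> \<Gamma>" using \<tau> openin_imp_subset by fastforce
    then obtain V where V: "open V" "z \<in> V" and spread: "\<And>W. \<lbrakk>openin (top_of_set \<Gamma>) W; W \<noteq> {}; W \<subseteq> V\<rbrakk>
      \<Longrightarrow> smallness_propagates \<Omega> W (\<Gamma> \<inter> V)" using local_propagation[of z] by blast
    have "smallness_propagates \<Omega> (\<tau> \<inter> V) (\<Gamma> \<inter> V)"
      using z V \<tau> by (intro spread) (auto simp: openin_open)
    then have "smallness_propagates \<Omega> \<tau> (\<Gamma> \<inter> V)" by (rule smallness_propagates_mono) auto
    then show ?thesis using z V by (auto simp: G_def)
  qed
  ultimately have "G = \<Gamma>" using \<Gamma>(1) unfolding connected_clopen by blast
  then have "K \<subseteq> \<Union>{N. open N \<and> smallness_propagates \<Omega> \<tau> (\<Gamma> \<inter> N)}"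
    using K by (auto simp: G_def)
  then obtain D where D: "D \<subseteq> {N. open N \<and> smallness_propagates \<Omega> \<tau> (\<Gamma> \<inter> N)}" "finite D" "K \<subseteq> \<Union>D"
    by (rule compactE[OF K(1)]) auto
  have "smallness_propagates \<Omega> \<tau> (\<Gamma> \<inter> \<Union>D)"
    using D(2,1)
  proof (induction D rule: finite_induct)
    case empty
    then show ?case by (simp add: smallness_propagates_empty)
  next
    case (insert N D)
    then have "smallness_propagates \<Omega> \<tau> ((\<Gamma> \<inter> N) \<union> (\<Gamma> \<inter> \<Union>D))"
      using \<Gamma>(2) by (intro smallness_propagates_Un) auto
    then show ?case by (simp add: Int_Un_distrib)
  qed
  then show ?thesis using D(3) K(2) smallness_propagates_mono by blast
qed

section \<open>Harmonic functions along analytic curves\<close>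

text \<open>
  The function \<open>z \<mapsto> cnj (F (q (cnj z)))\<close> is holomorphic as well, and at real parameters its mean with
  \<open>F (q z)\<close> is \<open>Re (F (q z))\<close>. The imaginary part of \<open>F c\<close> cancels in the mean, so only \<open>Re (F c)\<close> and the
  oscillation of \<open>F\<close> enter the bound.
\<close>

lemma harmonic_on_curve_extends:
  assumes S: "open \<Omega>" and u: "harmonic_on \<Omega> u" and M: "\<And>x. x \<in> \<Omega> \<Longrightarrow> \<bar>u x\<bar> \<le> M"
    and R: "0 < R" "\<And>z. z \<in> ball c R \<Longrightarrow> vec_of_complex z \<in> \<Omega>"
    and q: "q holomorphic_on ball (of_real t0) r" and qR: "q ` ball (of_real t0) r \<subseteq> ball c (R/2)"
  shows "\<exists>f. f holomorphic_on ball (of_real t0) r \<and>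
     (\<forall>z\<in>ball (of_real t0) r. cmod (f z) \<le> M + exp (2 * M)) \<and>
     (\<forall>t. of_real t \<in> ball (complex_of_real t0) r \<longrightarrow> f (of_real t) = of_real (u (vec_of_complex (q (of_real t)))))"
proof -
  let ?B = "ball (complex_of_real t0) r"
  obtain F where F: "F holomorphic_on ball c R" and Fu: "\<And>z. z \<in> ball c R \<Longrightarrow> Re (F z) = u (vec_of_complex z)"
    using harmonic_is_real_part[OF S u R(2)] by blast
  have ReF: "\<bar>Re (F z)\<bar> \<le> M" if "z \<in> ball c R" for z using Fu[OF that] M R(2) that by simp
  have Fc: "cmod (F z - F c) \<le> exp (2 * M)" if "z \<in> ball c (R/2)" for z
    using holomorphic_bounded_if_real_part_bounded[OF F R(1) ReF that] .
  have cnjB: "cnj z \<in> ?B" if "z \<in> ?B" for z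
  proof -
    have "of_real t0 - cnj z = cnj (of_real t0 - z)" by simp
    then have "cmod (of_real t0 - cnj z) = cmod (of_real t0 - z)" by (simp only: complex_mod_cnj)
    then show ?thesis using that by (simp only: mem_ball dist_norm)
  qed
  have qB: "q z \<in> ball c (R/2)" if "z \<in> ball (of_real t0) r" for z using qR that by blast
  have half: "ball c (R/2) \<subseteq> ball c R" using R by auto
  define f where "f z = (F (q z) + cnj (F (q (cnj z)))) / 2" for z
  have Fq: "(\<lambda>z. F (q z)) holomorphic_on ?B"
    using holomorphic_on_compose_gen[OF q holomorphic_on_subset[OF F half] qR] by (simp add: o_def)
  have "(\<lambda>z. F (q z)) holomorphic_on cnj ` ?B"
    by (rule holomorphic_on_subset[OF Fq]) (use cnjB in blast)
  from holomorphic_on_compose_cnj_cnj[OF this open_ball]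
  have "(\<lambda>z. cnj (F (q (cnj z)))) holomorphic_on ?B"
    by (simp add: o_def)
  then have "f holomorphic_on ?B"
    unfolding f_def by (intro holomorphic_intros Fq) auto
  moreover have "cmod (f z) \<le> M + exp (2 * M)" if z: "z \<in> ?B" for z
  proof -
    have "f z = of_real (Re (F c)) + ((F (q z) - F c) + cnj (F (q (cnj z)) - F c)) / 2"
      by (simp add: f_def complex_eq_iff field_simps)
    also have "cmod \<dots> \<le> cmod (of_real (Re (F c))) + (cmod (F (q z) - F c) + cmod (F (q (cnj z)) - F c)) / 2"
      using norm_triangle_ineq[of "F (q z) - F c" "cnj (F (q (cnj z)) - F c)"]
      by (intro norm_triangle_le add_left_mono) (simp add: norm_divide del: complex_cnj_diff)
    also have "\<dots> \<le> M + (exp (2 * M) + exp (2 * M)) / 2"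
      using ReF[of c] R Fc qB z cnjB by (intro add_mono divide_right_mono) auto
    finally show ?thesis by simp
  qed
  moreover have "f (of_real t) = of_real (u (vec_of_complex (q (of_real t))))" if "of_real t \<in> ?B" for t
    using Fu[of "q (of_real t)"] qB[OF that] half by (auto simp: f_def complex_eq_iff)
  ultimately show ?thesis by blast
qed

text \<open>
  The parameter range \<open>d\<close> is fixed before the segment \<open>[a, b]\<close>, which may be arbitrarily short; only the
  exponent and the constant depend on the segment.
\<close>

lemma smallness_propagates_on_analytic_curve:
  assumes S: "open \<Omega>" and q: "q holomorphic_on UNIV" and t0: "vec_of_complex (q (complex_of_real t0)) \<in> \<Omega>"
  defines "\<gamma> \<equiv> \<lambda>t. vec_of_complex (q (complex_of_real t))"
  shows "\<exists>d>0. \<forall>a b. a < b \<and> t0 - d \<le> a \<and> b \<le> t0 + d \<longrightarrow>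
     smallness_propagates \<Omega> (\<gamma> ` {a..b}) (\<gamma> ` {t0-d..t0+d})"
proof -
  obtain R where R: "0 < R" "ball (vec_of_complex (q (of_real t0))) R \<subseteq> \<Omega>" using S t0 openE by blast
  let ?c = "q (of_real t0)"
  have Rz: "vec_of_complex z \<in> \<Omega>" if "z \<in> ball ?c R" for z
    using R(2) that by (auto simp: subset_iff dist_vec_of_complex)
  have "isCont q (of_real t0)"
    using q by (meson holomorphic_on_imp_continuous_on continuous_on_eq_continuous_at open_UNIV UNIV_I)
  then obtain r where r: "0 < r" "\<And>z. dist z (of_real t0) < r \<Longrightarrow> dist (q z) ?c < R/2"
    unfolding continuous_at_eps_delta using R(1) by (metis half_gt_zero)
  define d where "d = r / 6"
  have d: "0 < d" "6 * d = r" using r by (simp_all add: d_def)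
  have qR: "q ` ball (of_real t0) r \<subseteq> ball ?c (R/2)" using r(2) by (auto simp: dist_commute)
  show ?thesis
  proof (intro exI[of _ d] conjI allI impI d)
    fix a b assume ab: "a < b \<and> t0 - d \<le> a \<and> b \<le> t0 + d"
    obtain \<kappa> where \<kappa>: "0 < \<kappa>" "\<kappa> < 1" and two: "\<And>K. 0 \<le> K \<Longrightarrow> \<exists>C>0. \<forall>f e. 
      f holomorphic_on ball (of_real t0) r \<and> (\<forall>z\<in>ball (of_real t0) r. cmod (f z) \<le> K)
      \<and> 0 \<le> e \<and> (\<forall>t\<in>{a..b}. cmod (f (of_real t)) \<le> e)
      \<longrightarrow> (\<forall>t\<in>{t0-d..t0+d}. cmod (f (of_real t)) \<le> C * e powr \<kappa>)"
      using two_constants_on_segment[OF d(1), of a b t0] ab unfolding d(2) by blast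
    have "\<exists>C>0. hoelder_estimate \<Omega> (\<gamma> ` {a..b}) (\<gamma> ` {t0-d..t0+d}) \<kappa> M C" if M: "0 < M" for M
    proof -
      have "0 \<le> M + exp (2*M)" using M by (simp add: add_nonneg_nonneg)
      from two[OF this] obtain C where C: "0 < C" and twoC: "\<And>f e t. \<lbrakk>f holomorphic_on ball (of_real t0) r;
          \<forall>z\<in>ball (of_real t0) r. cmod (f z) \<le> M + exp (2*M); 0 \<le> e; \<forall>t\<in>{a..b}. cmod (f (of_real t)) \<le> e;
          t \<in> {t0-d..t0+d}\<rbrakk> \<Longrightarrow> cmod (f (of_real t)) \<le> C * e powr \<kappa>"
        by blast
      have "hoelder_estimate \<Omega> (\<gamma> ` {a..b}) (\<gamma> ` {t0-d..t0+d}) \<kappa> M C"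
      proof (rule hoelder_estimateI)
        fix u e x
        assume u: "harmonic_on \<Omega> u" "\<forall>x\<in>\<Omega>. \<bar>u x\<bar> \<le> M" and e: "0 \<le> e" "\<forall>x\<in>\<gamma> ` {a..b}. \<bar>u x\<bar> \<le> e"
          and "x \<in> \<gamma> ` {t0-d..t0+d}"
        then obtain t where t: "t \<in> {t0-d..t0+d}" "x = \<gamma> t" by blast
        obtain f where f: "f holomorphic_on ball (of_real t0) r" "\<forall>z\<in>ball (of_real t0) r. cmod (f z) \<le> M + exp (2*M)"
          and fu: "\<And>t. of_real t \<in> ball (complex_of_real t0) r \<Longrightarrow> f (of_real t) = of_real (u (\<gamma> t))"
          using harmonic_on_curve_extends[OF S u(1) u(2)[rule_format] R(1) Rz holomorphic_on_subset[OF q subset_UNIV] qR]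
          unfolding \<gamma>_def by blast
        have fu': "cmod (f (of_real t)) = \<bar>u (\<gamma> t)\<bar>" if "t \<in> {t0-d..t0+d}" for t
          using that d by (subst fu) (auto simp: dist_norm simp flip: of_real_diff)
        have "\<forall>t\<in>{a..b}. cmod (f (of_real t)) \<le> e"
          using e(2) ab by (auto simp: fu')
        from twoC[OF f e(1) this t(1)] show "\<bar>u x\<bar> \<le> C * e powr \<kappa>" using fu'[OF t(1)] t(2) by simp
      qed
      then show ?thesis using C by blast
    qed
    then show "smallness_propagates \<Omega> (\<gamma> ` {a..b}) (\<gamma> ` {t0-d..t0+d})"
      unfolding smallness_propagates_def using \<kappa> by blast
  qed
qed

text \<open>
  The parameters of \<open>\<Gamma>\<close> form an interval that is not a single point, so every parameter is the limit
  of others.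
\<close>

lemma relatively_open_contains_arc:
  fixes \<gamma> :: "real \<Rightarrow> 'a::metric_space" and \<phi> :: "'a \<Rightarrow> real"
  assumes \<Gamma>: "connected \<Gamma>" and \<gamma>: "continuous_on UNIV \<gamma>" and \<phi>: "continuous_on UNIV \<phi>"
    and inv: "\<And>x. x \<in> \<Gamma> \<Longrightarrow> \<gamma> (\<phi> x) = x"
    and W: "openin (top_of_set \<Gamma>) W" "y \<in> W" and nontriv: "\<Gamma> \<noteq> {y}"
  shows "\<exists>a b. a < b \<and> \<gamma> ` {a..b} \<subseteq> W"
proof -
  obtain U where U: "open U" "W = \<Gamma> \<inter> U" using W(1) by (auto simp: openin_open)
  have y: "y \<in> \<Gamma>" "y \<in> U" using U W(2) by auto
  let ?S = "\<phi> ` \<Gamma>"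
  have S: "connected ?S" using \<Gamma> \<phi> by (intro connected_continuous_image) (auto intro: continuous_on_subset)
  have "open (\<gamma> -` U)" using \<gamma> U(1) by (simp add: continuous_on_open_vimage)
  moreover have "\<phi> y \<in> \<gamma> -` U" using y inv by simp
  ultimately obtain \<delta> where \<delta>: "0 < \<delta>" "ball (\<phi> y) \<delta> \<subseteq> \<gamma> -` U" using openE by blast
  have "?S \<noteq> {s}" for s
  proof
    assume "?S = {s}"
    then have "x = \<gamma> s" if "x \<in> \<Gamma>" for x using inv[OF that] that \<open>?S = {s}\<close> by (metis imageI singletonD)
    then show False using nontriv y(1) by blast
  qed
  then have "\<phi> y islimpt ?S" using connected_imp_perfect[OF S] y by blast
  then obtain s where s: "s \<in> ?S" "s \<noteq> \<phi> y" "dist s (\<phi> y) < \<delta>"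
    using \<delta>(1) unfolding islimpt_approachable by blast
  define a b where "a = min s (\<phi> y)" and "b = max s (\<phi> y)"
  have "\<gamma> t \<in> W" if t: "t \<in> {a..b}" for t
  proof -
    have "{a..b} \<subseteq> ?S"
      using s(1) y(1) by (intro connected_contains_Icc[OF S]) (auto simp: a_def b_def min_def max_def)
    then obtain g where "g \<in> \<Gamma>" "t = \<phi> g" using t by blast
    then have "\<gamma> t \<in> \<Gamma>" using inv by simp
    moreover have "t \<in> ball (\<phi> y) \<delta>"
      using t s(3) \<delta>(1) by (auto simp: a_def b_def dist_real_def)
    ultimately show ?thesis using \<delta>(2) U by blast
  qed
  moreover have "a < b" using s(2) by (auto simp: a_def b_def)
  ultimately show ?thesis by blast
qed

text \<open>
  A connected piece may be a single point; then \<open>W = \<Gamma>\<close>, and the estimate is the trivial one.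
\<close>

lemma parabola_piece_local_propagation:
  assumes S: "open \<Omega>" and \<Gamma>: "parabola_piece \<Gamma>" "\<Gamma> \<subseteq> \<Omega>" and x: "x \<in> \<Gamma>"
  shows "\<exists>V. open V \<and> x \<in> V \<and>
      (\<forall>W. openin (top_of_set \<Gamma>) W \<and> W \<noteq> {} \<and> W \<subseteq> V \<longrightarrow> smallness_propagates \<Omega> W (\<Gamma> \<inter> V))"
proof (cases "\<Gamma> = {x}")
  case True
  then show ?thesis
    using smallness_propagates_refl[OF \<Gamma>(2)] openin_imp_subset
    by (intro exI[of _ UNIV]) (auto dest: subset_singletonD openin_imp_subset)
next
  case False
  from \<Gamma>(1) obtain P where conn: "connected \<Gamma>" and P: "is_parabola P" "\<Gamma> \<subseteq> P"
    by (auto simp: parabola_piece_def)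
  obtain q \<phi> where q: "q holomorphic_on UNIV" and \<phi>: "continuous_on UNIV \<phi>"
    and \<phi>q: "\<And>t. \<phi> (vec_of_complex (q (complex_of_real t))) = t"
    and q\<phi>: "\<And>x. x \<in> P \<Longrightarrow> vec_of_complex (q (complex_of_real (\<phi> x))) = x"
    using parabola_entire_parametrization[OF P(1)] by blast
  define \<gamma> where "\<gamma> t = vec_of_complex (q (complex_of_real t))" for t
  have "isCont vec_of_complex z" for z
    using vec_of_complex_has_derivative has_derivative_continuous by blast
  then have vec_cont: "continuous_on UNIV vec_of_complex" 
    by (simp add: continuous_on_eq_continuous_at)
  have \<gamma>: "continuous_on UNIV \<gamma>"
    unfolding \<gamma>_def
    by (intro continuous_on_compose2[OF vec_cont] continuous_on_compose2[OF holomorphic_on_imp_continuous_on[OF q]]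
          continuous_intros) auto
  have \<gamma>\<phi>: "\<gamma> (\<phi> y) = y" if "y \<in> \<Gamma>" for y using q\<phi> P(2) that by (auto simp: \<gamma>_def)
  have "vec_of_complex (q (of_real (\<phi> x))) \<in> \<Omega>" using \<gamma>\<phi>[OF x] x \<Gamma>(2) by (auto simp: \<gamma>_def)
  from smallness_propagates_on_analytic_curve[OF S q this, folded \<gamma>_def]
  obtain d where d: "0 < d" and spread: "\<And>a b. \<lbrakk>a < b; \<phi> x - d \<le> a; b \<le> \<phi> x + d\<rbrakk> \<Longrightarrow>
     smallness_propagates \<Omega> (\<gamma> ` {a..b}) (\<gamma> ` {\<phi> x - d..\<phi> x + d})"
    by blast
  define V where "V = \<phi> -` {\<phi> x - d<..<\<phi> x + d}"
  show ?thesis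
  proof (intro exI[of _ V] conjI allI impI)
    show "open V" unfolding V_def using \<phi> by (simp add: continuous_on_open_vimage)
    show "x \<in> V" using d by (simp add: V_def)
    fix W assume W: "openin (top_of_set \<Gamma>) W \<and> W \<noteq> {} \<and> W \<subseteq> V"
    then obtain y where y: "y \<in> W" "\<Gamma> \<noteq> {y}"
      using False x by (metis ex_in_conv singletonD)
    obtain a b where ab: "a < b" "\<gamma> ` {a..b} \<subseteq> W"
      using relatively_open_contains_arc[OF conn \<gamma> \<phi> \<gamma>\<phi>, of W y] W y by blast
    have "\<phi> (\<gamma> t) \<in> {\<phi> x - d<..<\<phi> x + d}" if "t \<in> {a..b}" for t
    proof -
      have "\<gamma> t \<in> V" using ab(2) W that by blast
      then show ?thesis by (simp add: V_def)
    qed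
    then have "\<phi> x - d \<le> a" "b \<le> \<phi> x + d" using ab(1) \<phi>q by (auto simp: \<gamma>_def less_imp_le)
    from spread[OF ab(1) this] show "smallness_propagates \<Omega> W (\<Gamma> \<inter> V)"
    proof (rule smallness_propagates_mono)
      show "\<Gamma> \<inter> V \<subseteq> \<gamma> ` {\<phi> x - d..\<phi> x + d}"
      proof
        fix z assume "z \<in> \<Gamma> \<inter> V"
        then show "z \<in> \<gamma> ` {\<phi> x - d..\<phi> x + d}"
          using \<gamma>\<phi>[of z] by (intro image_eqI[of _ _ "\<phi> z"]) (auto simp: V_def)
      qed
    qed (use ab in blast)
  qed
qed

section \<open>The estimate in terms of suprema\<close>

theorem theorem2p1:
  fixes \<Omega> \<Gamma> T \<tau> :: "(real^2) set"
  assumes "open \<Omega>" and "connected \<Omega>"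
    and "parabola_piece \<Gamma>" and "\<Gamma> \<subseteq> \<Omega>"
    and "open_curve_in \<Gamma> \<tau>" and "open_curve_in \<Gamma> T"
    and "\<tau> \<subseteq> T" and "compactly_contained T \<Gamma>"
  shows "\<exists>\<kappa>. 0 < \<kappa> \<and> \<kappa> < 1 \<and>
    (\<forall>M>0. \<exists>C>0. \<forall>u :: real^2 \<Rightarrow> real.
       harmonic_on \<Omega> u \<and> bounded (u ` \<Omega>) \<and> C_norm \<Omega> u \<le> M \<longrightarrow>
       C_norm T u \<le> C * C_norm \<tau> u powr \<kappa>)"
proof -
  have \<tau>: "openin (top_of_set \<Gamma>) \<tau>" "\<tau> \<noteq> {}" and T: "T \<noteq> {}"
    using assms(5,6) by (auto simp: open_curve_in_def)
  have "\<tau> \<subseteq> \<Omega>" using \<tau>(1) assms(4) openin_imp_subset by blast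
  have "connected \<Gamma>" and cl: "compact (closure T)" "closure T \<subseteq> \<Gamma>"
    using assms(3,8) by (auto simp: parabola_piece_def compactly_contained_def)
  from smallness_propagates_compact[OF this(1) assms(4) parabola_piece_local_propagation[OF assms(1,3,4)] \<tau> cl]
  have "smallness_propagates \<Omega> \<tau> (closure T)" .
  then obtain \<kappa> where \<kappa>: "0 < \<kappa>" "\<kappa> < 1"
    and est: "\<forall>M>0. \<exists>C>0. hoelder_estimate \<Omega> \<tau> (closure T) \<kappa> M C"
    unfolding smallness_propagates_def by blast
  show ?thesis
  proof (rule exI[of _ \<kappa>], intro conjI \<kappa> allI impI)
    fix M :: real assume "0 < M"
    then obtain C where C: "0 < C" and estC: "hoelder_estimate \<Omega> \<tau> (closure T) \<kappa> M C"
      using est by blast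
    have "C_norm T u \<le> C * C_norm \<tau> u powr \<kappa>"
      if u: "harmonic_on \<Omega> u" and bdd: "bounded (u ` \<Omega>)" and M: "C_norm \<Omega> u \<le> M" for u
    proof -
      have bdd_abs: "bdd_above ((\<lambda>x. \<bar>u x\<bar>) ` \<Omega>)"
        using bdd by (auto simp: bounded_iff bdd_above_def)
      have le: "\<bar>u x\<bar> \<le> C_norm S u" if "x \<in> S" "S \<subseteq> \<Omega>" for x S
        unfolding C_norm_def using that bdd_above_mono[OF bdd_abs image_mono] by (intro cSUP_upper)
      have "\<forall>x\<in>\<Omega>. \<bar>u x\<bar> \<le> M" using le M by fastforce
      moreover have "\<forall>x\<in>\<tau>. \<bar>u x\<bar> \<le> C_norm \<tau> u" using le \<open>\<tau> \<subseteq> \<Omega>\<close> by blast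
      moreover have "0 \<le> C_norm \<tau> u"
        using calculation(2) \<tau>(2) by (meson abs_ge_zero ex_in_conv order_trans)
      ultimately have "\<forall>x\<in>closure T. \<bar>u x\<bar> \<le> C * C_norm \<tau> u powr \<kappa>"
        using hoelder_estimateD[OF estC u] by blast
      then show ?thesis
        unfolding C_norm_def[of T] using T closure_subset by (intro cSUP_least) auto
    qed
    then show "\<exists>C>0. \<forall>u. harmonic_on \<Omega> u \<and> bounded (u ` \<Omega>) \<and> C_norm \<Omega> u \<le> M \<longrightarrow>
       C_norm T u \<le> C * C_norm \<tau> u powr \<kappa>"
      using C by blast
  qed
qed


end
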